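(* Let $N$ and $A$ be finite-dimensional $\mathbb{C}$-algebras of the same dimension $n$, with $A$ semisimple, let $\mathcal{N}$ be a strongly flat deformation from $N$ to $A$, and let $d_1,\dots,d_n$ be a basis of $N$ over $\mathbb{C}$. Let $w_1,w_2,\dots$ be a sequence of $\mathbb{C}$-linear combinations of (noncommutative) products of $n$ variables. Let $T(d_1,\dots,d_n)\subseteq N$ be the $\mathbb{C}$-linear span of the elements $w_i(d_1,\dots,d_n)$, $i=1,2,\dots$, evaluated with the multiplication of $N$; and, for $s>0$ for which the specialisation $N_s$ of $\mathcal{N}$ at $t=s$ is defined and $b_1,\dots,b_n\in N_s$, let $T_s(b_1,\dots,b_n)\subseteq N_s$ be the $\mathbb{C}$-linear span of the elements $w_i(b_1,\dots,b_n)$, $i=1,2,\dots$, evaluated with the multiplication of $N_s$. Then for every real number $e>0$ there exist a real number $s$ with $0<s<e$ and elements $b_1,\dots,b_n\in N_s$ such that $$\dim_{\mathbb{C}}T(d_1,\dots,d_n)\le \dim_{\mathbb{C}}T_s(b_1,\dots,b_n).$$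
   Context: All algebras are associative with identity, usually noncommutative. $\mathbb{C}\{t\}$ denotes the ring of power series in $t$ with coefficients in $\mathbb{C}$, and for a finite-dimensional $\mathbb{C}$-algebra $N$, $N\{t\}$ denotes the set of power series in $t$ with coefficients in $N$, with its natural $\mathbb{C}\{t\}$-module structure. The $w_i$ are elements of the free associative unital algebra over $\mathbb{C}$ in $n$ noncommuting variables (the empty product, evaluated as the identity element, is allowed). Formal deformation: a formal deformation $\mathcal{N}=N\{t\}$ of $N$ is an associative $\mathbb{C}\{t\}$-bilinear multiplication $\circ_t$ on $N\{t\}$ such that for $a,b\in N$ the constant term (coefficient of $t^0$) of $a\circ_t b$ is the product $ab$ in $N$, and such that the identity element of $N$ acts as the identity of $N\{t\}$. Specialisation: write $d_i\circ_t d_j=\sum_{l=1}^n g_{i,j,l}(t)\,d_l$ with $g_{i,j,l}(t)\in\mathbb{C}\{t\}$. If all $g_{i,j,l}$ converge at $t=s$, the specialisation $N_s$ of $\mathcal{N}$ at $t=s$ is the $\mathbb{C}$-algebra with basis $d_1,\dots,d_n$ and multiplication $d_i\circ_s d_j=\sum_l g_{i,j,l}(s)\,d_l$. Thus $N_0=N$. Strongly flat deformation: let $N$ and $B$ be finite-dimensional $\mathbb{C}$-algebras of the same dimension. A formal deformation $\mathcal{N}$ of $N$ is a strongly flat deformation from $N$ to $B$ if (1) there is a real $c>0$ such that all $g_{i,j,l}(t)$ converge for $t\in[0,c)$ (so $N_s$ is defined for all $s\in[0,c)$), and $N_{t_0}\cong B$ for some $t_0\in(0,c)$; and (2) for every real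 $\epsilon>0$ there is $s$ with $0<s<\epsilon$ such that $N_s\cong B$. *)

theory Defs
  imports "HOL-Analysis.FPS_Convergence" "HOL-Library.Poly_Mapping"
begin

text \<open>The underlying space of an algebra is a type, but its operations are explicit data, since a
  deformation puts many multiplications on the same space. The zero algebra is allowed.\<close>

record 'a calg =
  scl :: "complex \<Rightarrow> 'a \<Rightarrow> 'a"
  mul :: "'a \<Rightarrow> 'a \<Rightarrow> 'a"
  unit :: 'a

locale complex_algebra =
  vector_space "scl N" for N :: "'a::ab_group_add calg" +
  assumes mul_add_left: "mul N (x + y) z = mul N x z + mul N y z"
    and mul_add_right: "mul N x (y + z) = mul N x y + mul N x z"
    and mul_scl_left: "mul N (scl N c x) y = scl N c (mul N x y)"
    and mul_scl_right: "mul N x (scl N c y) = scl N c (mul N x y)"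
    and mul_assoc: "mul N (mul N x y) z = mul N x (mul N y z)"
    and unit_left: "mul N (unit N) x = x"
    and unit_right: "mul N x (unit N) = x"

text \<open>Finite-dimensionality is separate from the dimension because \<^const>\<open>vector_space.dim\<close> is 0 on
  infinite-dimensional spaces.\<close>

definition finite_dim :: "'a::ab_group_add calg \<Rightarrow> bool" where
  "finite_dim N \<longleftrightarrow> (\<exists>B. finite B \<and> module.span (scl N) B = UNIV)"

definition is_basis :: "'a::ab_group_add calg \<Rightarrow> nat \<Rightarrow> (nat \<Rightarrow> 'a) \<Rightarrow> bool" where
  "is_basis N n d \<longleftrightarrow> inj_on d {..<n} \<and> \<not> module.dependent (scl N) (d ` {..<n})
     \<and> module.span (scl N) (d ` {..<n}) = UNIV"

definition coord :: "'a::ab_group_add calg \<Rightarrow> nat \<Rightarrow> (nat \<Rightarrow> 'a) \<Rightarrow> 'a \<Rightarrow> nat \<Rightarrow> complex" where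
  "coord N n d x l = module.representation (scl N) (d ` {..<n}) x (d l)"

definition left_ideal :: "'a::ab_group_add calg \<Rightarrow> 'a set \<Rightarrow> bool" where
  "left_ideal N I \<longleftrightarrow> module.subspace (scl N) I \<and> (\<forall>a. \<forall>x\<in>I. mul N a x \<in> I)"

definition simple_left_ideal :: "'a::ab_group_add calg \<Rightarrow> 'a set \<Rightarrow> bool" where
  "simple_left_ideal N I \<longleftrightarrow> left_ideal N I \<and> I \<noteq> {0}
     \<and> (\<forall>J. left_ideal N J \<and> J \<subseteq> I \<longrightarrow> J = {0} \<or> J = I)"

text \<open>The regular left module is a sum of simple submodules.\<close>

definition semisimple :: "'a::ab_group_add calg \<Rightarrow> bool" where
  "semisimple N \<longleftrightarrow> module.span (scl N) (\<Union>{I. simple_left_ideal N I}) = UNIV"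

definition calg_isomorphic :: "'a::ab_group_add calg \<Rightarrow> 'b::ab_group_add calg \<Rightarrow> bool" where
  "calg_isomorphic N B \<longleftrightarrow> (\<exists>\<phi>. Vector_Spaces.linear (scl N) (scl B) \<phi> \<and> bij \<phi>
     \<and> (\<forall>x y. \<phi> (mul N x y) = mul B (\<phi> x) (\<phi> y)) \<and> \<phi> (unit N) = unit B)"

text \<open>\<^typ>\<open>'a fps\<close> serves as the set of power series with coefficients in the algebra; the library's
  product on it is not used, only the Cauchy-product action of the complex power series.\<close>

definition fps_scl :: "'a::ab_group_add calg \<Rightarrow> complex fps \<Rightarrow> 'a fps \<Rightarrow> 'a fps" where
  "fps_scl N f x = Abs_fps (\<lambda>k. \<Sum>i=0..k. scl N (fps_nth f i) (fps_nth x (k - i)))"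

definition formal_deformation ::
    "'a::ab_group_add calg \<Rightarrow> ('a fps \<Rightarrow> 'a fps \<Rightarrow> 'a fps) \<Rightarrow> bool" where
  "formal_deformation N m \<longleftrightarrow>
     (\<forall>x y z. m (x + y) z = m x z + m y z) \<and>
     (\<forall>x y z. m x (y + z) = m x y + m x z) \<and>
     (\<forall>f x y. m (fps_scl N f x) y = fps_scl N f (m x y)) \<and>
     (\<forall>f x y. m x (fps_scl N f y) = fps_scl N f (m x y)) \<and>
     (\<forall>x y z. m (m x y) z = m x (m y z)) \<and>
     (\<forall>a b. fps_nth (m (fps_const a) (fps_const b)) 0 = mul N a b) \<and>
     (\<forall>x. m (fps_const (unit N)) x = x \<and> m x (fps_const (unit N)) = x)"

definition struct_series ::
    "'a::ab_group_add calg \<Rightarrow> ('a fps \<Rightarrow> 'a fps \<Rightarrow> 'a fps) \<Rightarrow> nat \<Rightarrow> (nat \<Rightarrow> 'a)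
      \<Rightarrow> nat \<Rightarrow> nat \<Rightarrow> nat \<Rightarrow> complex fps" where
  "struct_series N m n d i j l =
     Abs_fps (\<lambda>k. coord N n d (fps_nth (m (fps_const (d i)) (fps_const (d j))) k) l)"

definition converges_at ::
    "'a::ab_group_add calg \<Rightarrow> ('a fps \<Rightarrow> 'a fps \<Rightarrow> 'a fps) \<Rightarrow> nat \<Rightarrow> (nat \<Rightarrow> 'a) \<Rightarrow> complex \<Rightarrow> bool" where
  "converges_at N m n d s \<longleftrightarrow> (\<forall>i<n. \<forall>j<n. \<forall>l<n.
     summable (\<lambda>k. fps_nth (struct_series N m n d i j l) k * s ^ k))"

text \<open>Meaningful only where \<^const>\<open>converges_at\<close> holds. The identity of \<^term>\<open>N\<close> is kept, because it
  acts as the identity of the whole deformation and hence of each specialisation.\<close>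

definition specialisation ::
    "'a::ab_group_add calg \<Rightarrow> ('a fps \<Rightarrow> 'a fps \<Rightarrow> 'a fps) \<Rightarrow> nat \<Rightarrow> (nat \<Rightarrow> 'a) \<Rightarrow> complex \<Rightarrow> 'a calg" where
  "specialisation N m n d s =
     \<lparr>scl = scl N,
      mul = (\<lambda>x y. \<Sum>i<n. \<Sum>j<n. \<Sum>l<n.
        scl N (coord N n d x i * coord N n d y j * eval_fps (struct_series N m n d i j l) s) (d l)),
      unit = unit N\<rparr>"

definition strongly_flat ::
    "'a::ab_group_add calg \<Rightarrow> ('a fps \<Rightarrow> 'a fps \<Rightarrow> 'a fps) \<Rightarrow> nat \<Rightarrow> (nat \<Rightarrow> 'a)
      \<Rightarrow> 'b::ab_group_add calg \<Rightarrow> bool" where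
  "strongly_flat N m n d B \<longleftrightarrow> formal_deformation N m \<and>
     (\<exists>c::real. c > 0 \<and>
        (\<forall>t::real. 0 \<le> t \<and> t < c \<longrightarrow> converges_at N m n d (of_real t)) \<and>
        (\<exists>t\<^sub>0::real. 0 < t\<^sub>0 \<and> t\<^sub>0 < c \<and> calg_isomorphic (specialisation N m n d (of_real t\<^sub>0)) B)) \<and>
     (\<forall>\<epsilon>::real. \<epsilon> > 0 \<longrightarrow> (\<exists>s::real. 0 < s \<and> s < \<epsilon> \<and> converges_at N m n d (of_real s) \<and>
        calg_isomorphic (specialisation N m n d (of_real s)) B))"

text \<open>An element of the free algebra on \<open>n\<close> letters is a finitely supported function on the words
  with letters below \<open>n\<close>.\<close>

definition in_free_algebra :: "nat \<Rightarrow> (nat list \<Rightarrow>\<^sub>0 complex) \<Rightarrow> bool" where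
  "in_free_algebra n w \<longleftrightarrow> (\<forall>u\<in>Poly_Mapping.keys w. set u \<subseteq> {..<n})"

definition eval_word :: "'a calg \<Rightarrow> (nat \<Rightarrow> 'a) \<Rightarrow> nat list \<Rightarrow> 'a" where
  "eval_word N b u = foldr (\<lambda>i x. mul N (b i) x) u (unit N)"

definition eval_free :: "'a::ab_group_add calg \<Rightarrow> (nat \<Rightarrow> 'a) \<Rightarrow> (nat list \<Rightarrow>\<^sub>0 complex) \<Rightarrow> 'a" where
  "eval_free N b w = (\<Sum>u\<in>Poly_Mapping.keys w. scl N (Poly_Mapping.lookup w u) (eval_word N b u))"

definition T_space ::
    "'a::ab_group_add calg \<Rightarrow> (nat \<Rightarrow> nat list \<Rightarrow>\<^sub>0 complex) \<Rightarrow> (nat \<Rightarrow> 'a) \<Rightarrow> 'a set" where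
  "T_space N w b = module.span (scl N) (range (\<lambda>i. eval_free N b (w i)))"


context complex_algebra begin

lemma coord_sum:
  assumes "is_basis N n d"
  shows "(\<Sum>l<n. scl N (coord N n d x l) (d l)) = x"
proof -
  have "(\<Sum>l<n. scl N (coord N n d x l) (d l))
      = (\<Sum>b\<in>d ` {..<n}. scl N (representation (d ` {..<n}) x b) b)"
    using assms by (simp add: coord_def is_basis_def sum.reindex)
  also have "\<dots> = x"
    using assms by (intro sum_representation_eq) (auto simp: is_basis_def)
  finally show ?thesis .
qed

lemma struct_series_expansion:
  assumes "is_basis N n d"
  shows "m (fps_const (d i)) (fps_const (d j))
    = (\<Sum>l<n. fps_scl N (struct_series N m n d i j l) (fps_const (d l)))"
proof (rule fps_ext)
  fix k
  have *: "fps_nth (fps_scl N f (fps_const a)) k = scl N (fps_nth f k) a" for f a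
  proof -
    have "fps_nth (fps_scl N f (fps_const a)) k
        = (\<Sum>i=0..k. if i = k then scl N (fps_nth f k) a else 0)"
      by (simp only: fps_scl_def fps_nth_Abs_fps, rule sum.cong) auto
    then show ?thesis by simp
  qed
  show "fps_nth (m (fps_const (d i)) (fps_const (d j))) k
    = fps_nth (\<Sum>l<n. fps_scl N (struct_series N m n d i j l) (fps_const (d l))) k"
    by (simp add: fps_sum_nth * struct_series_def coord_sum[OF assms])
qed

lemma mul_sum_left: "mul N (\<Sum>i\<in>I. f i) y = (\<Sum>i\<in>I. mul N (f i) y)"
proof -
  interpret additive "\<lambda>x. mul N x y" by standard (rule mul_add_left)
  show ?thesis by (rule sum)
qed

lemma mul_sum_right: "mul N x (\<Sum>i\<in>I. f i) = (\<Sum>i\<in>I. mul N x (f i))"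
proof -
  interpret additive "mul N x" by standard (rule mul_add_right)
  show ?thesis by (rule sum)
qed

lemma specialisation_0:
  assumes "is_basis N n d" and "formal_deformation N m"
  shows "specialisation N m n d 0 = N"
proof -
  have e: "eval_fps (struct_series N m n d i j l) 0 = coord N n d (mul N (d i) (d j)) l" for i j l
    using assms(2) by (simp add: eval_fps_at_0 struct_series_def formal_deformation_def)
  have "mul (specialisation N m n d 0) x y = mul N x y" for x y
  proof -
    have "mul N x y = mul N (\<Sum>i<n. scl N (coord N n d x i) (d i)) (\<Sum>j<n. scl N (coord N n d y j) (d j))"
      by (simp add: coord_sum[OF assms(1)])
    also have "\<dots> = (\<Sum>i<n. \<Sum>j<n. scl N (coord N n d x i * coord N n d y j) (mul N (d i) (d j)))"
      by (simp only: mul_sum_left, simp only: mul_sum_right mul_scl_left mul_scl_right scale_scale, simp only: mult.commute)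
    also have "\<dots> = (\<Sum>i<n. \<Sum>j<n. scl N (coord N n d x i * coord N n d y j)
        (\<Sum>l<n. scl N (coord N n d (mul N (d i) (d j)) l) (d l)))"
      by (simp add: coord_sum[OF assms(1)])
    finally show ?thesis
      by (simp add: specialisation_def e scale_sum_right)
  qed
  then show ?thesis
    by (intro calg.equality) (auto simp: fun_eq_iff specialisation_def)
qed

end

end

theory Submission
  imports Defs
begin

text \<open>The elements \<open>b\<^sub>i = d\<^sub>i\<close> work for every sufficiently small \<open>s\<close> at which the structure series
  converge. In the basis \<open>d\<close>, the coordinates of a fixed noncommutative polynomial \<open>w(d)\<close>, evaluated
  in the specialisation at \<open>s\<close>, are polynomials in the numbers \<open>g\<^sub>i\<^sub>j\<^sub>l(s)\<close>. Convergence on a whole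
  interval \<open>[0,c)\<close> gives the power series \<open>g\<^sub>i\<^sub>j\<^sub>l\<close> a positive radius of convergence, so these
  coordinates are continuous at \<open>s = 0\<close>, where the specialisation is \<open>N\<close> itself
  (\<open>tendsto_coord_eval_word\<close>). Choose among the \<open>w\<^sub>i(d)\<close> a basis of \<open>T(d)\<close>. Linear independence of
  finitely many vectors is an open condition (\<open>eventually_independent_image\<close>), so for small \<open>s\<close> the
  same polynomials yield equally many independent elements of \<open>T\<^sub>s(d)\<close>.\<close>

text \<open>The matrix of the values \<open>f v (x v')\<close> is strictly diagonally dominant, hence invertible: in a
  vanishing combination of the \<open>x v\<close>, the functional belonging to the largest coefficient shows that
  this coefficient is smaller in norm than itself.\<close>

lemma independent_if_almost_dual:
  fixes scale :: "'k::real_normed_field \<Rightarrow> 'v::ab_group_add \<Rightarrow> 'v"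
    and f :: "'i \<Rightarrow> 'v \<Rightarrow> 'k" and x :: "'i \<Rightarrow> 'v"
  assumes "vector_space scale" and "finite S"
    and lin: "\<And>v. v \<in> S \<Longrightarrow> Vector_Spaces.linear scale (*) (f v)"
    and near: "\<And>u v. u \<in> S \<Longrightarrow> v \<in> S \<Longrightarrow>
      norm (f u (x v) - (if u = v then 1 else 0)) < 1 / (1 + real (card S))"
  shows "inj_on x S" and "\<not> module.dependent scale (x ` S)"
proof -
  interpret vector_space scale by fact
  show inj: "inj_on x S"
  proof (rule inj_onI, rule ccontr)
    fix u v assume uv: "u \<in> S" "v \<in> S" "x u = x v" "u \<noteq> v"
    \<comment> \<open>Two distinct indices give \<open>card S \<ge> 2\<close>, so the common value \<open>f u (x u)\<close> would lie within
      \<open>1 / 2\<close> of both \<open>1\<close> and \<open>0\<close>.\<close>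
    have "card {u, v} \<le> card S"
      using uv \<open>finite S\<close> by (intro card_mono) auto
    then have "1 / (1 + real (card S)) \<le> 1 / 2"
      using uv by (intro divide_left_mono) auto
    then have *: "norm (f u (x u) - 1) < 1 / 2" "norm (f u (x u)) < 1 / 2"
      using near[OF uv(1) uv(1)] near[OF uv(1,2)] uv(3,4)
      by (auto simp del: le_divide_eq_numeral1 divide_le_eq_numeral1 elim: less_le_trans)
    have "norm (1 :: 'k) \<le> norm (f u (x u) - 1) + norm (f u (x u))"
      using norm_triangle_ineq4[of "f u (x u)" "f u (x u) - 1"] by simp
    with * show False by simp
  qed
  have coeffs: "\<forall>v\<in>S. c v = 0" if c0: "(\<Sum>v\<in>S. scale (c v) (x v)) = 0" for c
  proof (rule ccontr)
    assume "\<not> (\<forall>v\<in>S. c v = 0)"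
    then obtain v0 where v0: "v0 \<in> S" "c v0 \<noteq> 0" by blast
    then have "Max ((\<lambda>v. norm (c v)) ` S) \<in> (\<lambda>v. norm (c v)) ` S"
      using \<open>finite S\<close> by (intro Max_in) auto
    then obtain k where "k \<in> S" and "Max ((\<lambda>v. norm (c v)) ` S) = norm (c k)"
      by blast
    then have k: "k \<in> S" "\<And>v. v \<in> S \<Longrightarrow> norm (c v) \<le> norm (c k)"
      using \<open>finite S\<close> Max_ge[of "(\<lambda>v. norm (c v)) ` S"] by auto
    have pos: "norm (c k) > 0"
      using v0 k(2)[of v0] by auto
    interpret f: Vector_Spaces.linear scale "(*)" "f k" by (rule lin) fact
    have "0 = (\<Sum>v\<in>S. c v * f k (x v))"
      using arg_cong[OF c0, of "f k"] by (simp add: f.sum f.scale)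
    also have "\<dots> = (\<Sum>v\<in>S. c v * (f k (x v) - (if k = v then 1 else 0)))
        + (\<Sum>v\<in>S. if k = v then c v else 0)"
      unfolding sum.distrib[symmetric] by (intro sum.cong) (auto simp: algebra_simps)
    also have "(\<Sum>v\<in>S. if k = v then c v else 0) = c k"
      using k \<open>finite S\<close> by simp
    finally have "norm (c k) = norm (\<Sum>v\<in>S. c v * (f k (x v) - (if k = v then 1 else 0)))"
      by (metis add_eq_0_iff norm_minus_cancel)
    also have "\<dots> \<le> (\<Sum>v\<in>S. norm (c k) * (1 / (1 + real (card S))))"
      unfolding norm_mult
      by (intro sum_norm_le, unfold norm_mult, intro mult_mono k(2) less_imp_le[OF near] k(1)) auto
    also have "\<dots> < norm (c k)"
      using pos by (simp add: field_simps)
    finally show False by simp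
  qed
  show "\<not> dependent (x ` S)"
  proof (rule independent_if_scalars_zero)
    fix c y assume "(\<Sum>y\<in>x ` S. scale (c y) y) = 0" "y \<in> x ` S"
    then show "c y = 0"
      using coeffs[of "c \<circ> x"] by (auto simp: sum.reindex[OF inj])
  qed (use \<open>finite S\<close> in simp)
qed

text \<open>Convergence is asked only after each linear functional, which spares choosing a topology on the
  vector space. The coordinate functionals of a basis extending \<open>S\<close> are dual to \<open>S\<close>, hence almost dual
  to nearby families.\<close>

lemma eventually_independent_image:
  fixes scale :: "'k::real_normed_field \<Rightarrow> 'v::ab_group_add \<Rightarrow> 'v"
  assumes "vector_space scale" and "finite S" and indep: "\<not> module.dependent scale S"
    and lim: "\<And>f v. Vector_Spaces.linear scale (*) f \<Longrightarrow> v \<in> S \<Longrightarrow> ((\<lambda>s. f (x s v)) \<longlongrightarrow> f v) F"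
  shows "\<forall>\<^sub>F s in F. inj_on (x s) S \<and> \<not> module.dependent scale (x s ` S)"
proof -
  interpret vector_space scale by fact
  define B where "B = extend_basis S"
  have B: "S \<subseteq> B" "independent B" "span B = UNIV"
    using indep by (auto simp: B_def extend_basis_superset independent_extend_basis)
  define f where "f u y = representation B y u" for u y
  have lin: "Vector_Spaces.linear scale (*) (f u)" for u
    unfolding f_def by (rule linear_representation) fact+
  have dual: "f u v = (if u = v then 1 else 0)" if "v \<in> S" for u v
    unfolding f_def using representation_basis[OF B(2), of v] B(1) that by auto
  have "\<forall>\<^sub>F s in F. \<forall>u\<in>S. \<forall>v\<in>S.
      norm (f u (x s v) - (if u = v then 1 else 0)) < 1 / (1 + real (card S))"
  proof (intro eventually_ball_finite \<open>finite S\<close> ballI)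
    fix u v assume "u \<in> S" "v \<in> S"
    then show "\<forall>\<^sub>F s in F. norm (f u (x s v) - (if u = v then 1 else 0)) < 1 / (1 + real (card S))"
      using tendstoD[OF lim[OF lin \<open>v \<in> S\<close>, of u], of "1 / (1 + real (card S))"]
      by (simp add: dual dist_norm)
  qed
  then show ?thesis
  proof eventually_elim
    case (elim s)
    show ?case
      using independent_if_almost_dual[where f = f and x = "x s", OF assms(1,2) lin] elim by blast
  qed
qed

context complex_algebra
begin

lemma linear_coord:
  assumes "is_basis N n d"
  shows "Vector_Spaces.linear (scl N) (*) (\<lambda>x. coord N n d x l)"
  unfolding coord_def using assms by (intro linear_representation) (auto simp: is_basis_def)

lemma coord_basis:
  assumes "is_basis N n d" and "k < n" and "l < n"
  shows "coord N n d (d k) l = of_bool (k = l)"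
proof -
  have "representation (d ` {..<n}) (d k) = (\<lambda>v. if v = d k then 1 else 0)"
    using assms by (intro representation_basis) (auto simp: is_basis_def)
  moreover have "d l = d k \<longleftrightarrow> k = l"
    using assms by (auto simp: is_basis_def inj_on_def)
  ultimately show ?thesis by (simp add: coord_def)
qed

lemma coord_mul_specialisation:
  assumes "is_basis N n d" and "l < n"
  shows "coord N n d (mul (specialisation N m n d s) x y) l =
    (\<Sum>i<n. \<Sum>j<n. coord N n d x i * coord N n d y j * eval_fps (struct_series N m n d i j l) s)"
proof -
  interpret f: Vector_Spaces.linear "scl N" "(*)" "\<lambda>x. coord N n d x l"
    using assms(1) by (rule linear_coord)
  have "{..<n} \<inter> {l} = {l}"
    using assms(2) by auto
  then show ?thesis
    by (simp add: specialisation_def f.sum f.scale coord_basis[OF assms(1) _ assms(2)])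
qed

text \<open>The coordinates of the identity and of the letters do not depend on the parameter, and each
  further multiplication by a letter is a polynomial in the structure constants; hence the
  induction on the word. Writing \<open>N\<close> as the specialisation at \<open>0\<close> identifies the limit.\<close>

lemma tendsto_coord_eval_word:
  assumes d: "is_basis N n d" and "formal_deformation N m" and "l < n"
    and cont: "\<And>i j l. i < n \<Longrightarrow> j < n \<Longrightarrow> l < n \<Longrightarrow> isCont (eval_fps (struct_series N m n d i j l)) 0"
  shows "((\<lambda>s. coord N n d (eval_word (specialisation N m n d s) d u) l)
    \<longlongrightarrow> coord N n d (eval_word N d u) l) (at 0)"
  using \<open>l < n\<close>
proof (induction u arbitrary: l)
  case Nil
  then show ?case by (simp add: eval_word_def specialisation_def)
next
  case (Cons k u)
  have "((\<lambda>s. coord N n d (eval_word (specialisation N m n d s) d (k # u)) l)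
    \<longlongrightarrow> (\<Sum>i<n. \<Sum>j<n. coord N n d (d k) i * coord N n d (eval_word N d u) j
        * eval_fps (struct_series N m n d i j l) 0)) (at 0)"
    unfolding eval_word_def foldr.simps comp_apply coord_mul_specialisation[OF d Cons.prems]
    by (intro tendsto_sum tendsto_mult tendsto_const Cons.IH[unfolded eval_word_def]
        cont[unfolded isCont_def]) (use Cons.prems in auto)
  also have "(\<Sum>i<n. \<Sum>j<n. coord N n d (d k) i * coord N n d (eval_word N d u) j
        * eval_fps (struct_series N m n d i j l) 0)
      = coord N n d (mul (specialisation N m n d 0) (d k) (eval_word N d u)) l"
    by (rule coord_mul_specialisation[symmetric]) fact+
  also have "\<dots> = coord N n d (eval_word N d (k # u)) l"
    using assms by (simp add: specialisation_0 eval_word_def)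
  finally show ?case .
qed

lemma tendsto_linear_eval_free:
  assumes d: "is_basis N n d" and m: "formal_deformation N m"
    and cont: "\<And>i j l. i < n \<Longrightarrow> j < n \<Longrightarrow> l < n \<Longrightarrow> isCont (eval_fps (struct_series N m n d i j l)) 0"
    and f: "Vector_Spaces.linear (scl N) (*) f"
  shows "((\<lambda>s. f (eval_free (specialisation N m n d s) d p)) \<longlongrightarrow> f (eval_free N d p)) (at 0)"
proof -
  interpret f: Vector_Spaces.linear "scl N" "(*)" f by fact
  have f_eq: "f x = (\<Sum>l<n. coord N n d x l * f (d l))" for x
    using arg_cong[OF coord_sum[OF d, of x], of f] by (simp add: f.sum f.scale)
  have scl: "scl (specialisation N m n d s) = scl N" for s
    by (simp add: specialisation_def)
  have word: "((\<lambda>s. f (eval_word (specialisation N m n d s) d u)) \<longlongrightarrow> f (eval_word N d u)) (at 0)" for u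
    unfolding f_eq[of "eval_word _ _ _"]
    by (intro tendsto_intros tendsto_coord_eval_word[OF d m _ cont]) auto
  show ?thesis
    by (simp add: eval_free_def scl f.sum f.scale) (intro tendsto_intros word)
qed

end

text \<open>By Abel's lemma, convergence at a single point other than \<open>0\<close> gives a disc of convergence.\<close>

lemma isCont_eval_struct_series:
  assumes "converges_at N m n d z" and "z \<noteq> 0" and "i < n" "j < n" "l < n"
  shows "isCont (eval_fps (struct_series N m n d i j l)) 0"
proof -
  have "0 < ereal (norm z)" using assms(2) by simp
  also have "\<dots> \<le> fps_conv_radius (struct_series N m n d i j l)"
    using assms unfolding converges_at_def fps_conv_radius_def by (intro conv_radius_geI) auto
  finally show ?thesis
    by (intro continuous_eval_fps) (simp add: zero_ereal_def)
qed

theorem proposition23: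
  fixes N :: "'a::ab_group_add calg" and A :: "'b::ab_group_add calg"
    and m :: "'a fps \<Rightarrow> 'a fps \<Rightarrow> 'a fps"
    and n :: nat and d :: "nat \<Rightarrow> 'a"
    and w :: "nat \<Rightarrow> nat list \<Rightarrow>\<^sub>0 complex"
  assumes "complex_algebra N" and "finite_dim N" and "vector_space.dim (scl N) UNIV = n"
    and "complex_algebra A" and "finite_dim A" and "vector_space.dim (scl A) UNIV = n"
    and "semisimple A"
    and "is_basis N n d"
    and "strongly_flat N m n d A"
    and "\<And>i. in_free_algebra n (w i)"
  shows "\<forall>e::real. e > 0 \<longrightarrow>
    (\<exists>(s::real) (b :: nat \<Rightarrow> 'a). 0 < s \<and> s < e \<and> converges_at N m n d (of_real s) \<and>
      vector_space.dim (scl N) (T_space N w d)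
        \<le> vector_space.dim (scl (specialisation N m n d (of_real s)))
            (T_space (specialisation N m n d (of_real s)) w b))"
proof (intro allI impI)
  fix e :: real assume "e > 0"
  interpret N: complex_algebra N by fact
  interpret N: finite_dimensional_vector_space "scl N" "d ` {..<n}"
    using \<open>is_basis N n d\<close> by unfold_locales (auto simp: is_basis_def)
  let ?Ns = "\<lambda>s. specialisation N m n d s"
  obtain c :: real where c: "c > 0"
    "\<And>t::real. 0 \<le> t \<Longrightarrow> t < c \<Longrightarrow> converges_at N m n d (of_real t)"
    using \<open>strongly_flat N m n d A\<close> unfolding strongly_flat_def by blast
  have m: "formal_deformation N m"
    using \<open>strongly_flat N m n d A\<close> unfolding strongly_flat_def by blast
  have cont: "isCont (eval_fps (struct_series N m n d i j l)) 0" if "i < n" "j < n" "l < n" for i j l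
    using c(1) that by (intro isCont_eval_struct_series[OF c(2)[of "c / 2"]]) auto
  have real0: "filterlim (of_real :: real \<Rightarrow> complex) (at 0) (at_right 0)"
    unfolding filterlim_at by (auto simp: eventually_at_filter intro!: tendsto_eq_intros)

  \<comment> \<open>Each element \<open>v\<close> of a basis \<open>S\<close> of \<open>T(d)\<close> is the value of one of the polynomials, of index
    \<open>idx v\<close>; the same polynomial evaluated at \<open>d\<close> in \<open>N\<^sub>s\<close> is the perturbation \<open>x s v\<close> of \<open>v\<close>.\<close>
  obtain S where "S \<subseteq> range (\<lambda>i. eval_free N d (w i))" "N.independent S"
      "card S = N.dim (range (\<lambda>i. eval_free N d (w i)))"
    by (rule N.basis_exists)
  then have S: "S \<subseteq> range (\<lambda>i. eval_free N d (w i))" "N.independent S"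
      "card S = N.dim (T_space N w d)"
    by (auto simp: T_space_def)
  define idx where "idx = inv (\<lambda>i. eval_free N d (w i))"
  have idx: "eval_free N d (w (idx v)) = v" if "v \<in> S" for v
    unfolding idx_def by (rule f_inv_into_f[where f = "\<lambda>i. eval_free N d (w i)"]) (rule subsetD[OF S(1) that])
  define x where "x s v = eval_free (?Ns (of_real s)) d (w (idx v))" for s :: real and v
  have "\<forall>\<^sub>F s in at_right 0. inj_on (x s) S \<and> N.independent (x s ` S)"
  proof (rule eventually_independent_image)
    fix f v assume "Vector_Spaces.linear (scl N) (*) f" "v \<in> S"
    then show "((\<lambda>s. f (x s v)) \<longlongrightarrow> f v) (at_right 0)"
      using filterlim_compose[OF N.tendsto_linear_eval_free[OF \<open>is_basis N n d\<close> m cont] real0, of f "w (idx v)"]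
      by (simp add: x_def idx)
  qed (fact N.vector_space_axioms N.finiteI_independent[OF S(2)] S(2))+
  moreover have "\<forall>\<^sub>F s in at_right 0. s \<in> {0<..<min e c}"
    using \<open>e > 0\<close> c(1) by (intro eventually_at_right_real) auto
  ultimately have "\<forall>\<^sub>F s in at_right 0.
      (inj_on (x s) S \<and> N.independent (x s ` S)) \<and> s \<in> {0<..<min e c}"
    by (rule eventually_conj)
  then have "\<exists>s. (inj_on (x s) S \<and> N.independent (x s ` S)) \<and> s \<in> {0<..<min e c}"
    by (rule eventually_happens'[OF trivial_limit_at_right_real])
  then obtain s where "(inj_on (x s) S \<and> N.independent (x s ` S)) \<and> s \<in> {0<..<min e c}"
    by (rule exE)
  then have s: "inj_on (x s) S" "N.independent (x s ` S)" "0 < s" "s < e" "s < c"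
    by auto

  have scl: "scl (?Ns (of_real s)) = scl N"
    by (simp add: specialisation_def)
  have "N.dim (T_space N w d) = card (x s ` S)"
    using S(3) s(1) by (simp add: card_image)
  also have "\<dots> \<le> N.dim (T_space (?Ns (of_real s)) w d)"
  proof (rule N.independent_card_le_dim[OF _ s(2)])
    show "x s ` S \<subseteq> T_space (?Ns (of_real s)) w d"
      unfolding T_space_def scl x_def by (auto intro!: N.span_base)
  qed
  finally show "\<exists>(s::real) b. 0 < s \<and> s < e \<and> converges_at N m n d (of_real s) \<and>
      N.dim (T_space N w d) \<le> vector_space.dim (scl (?Ns (of_real s))) (T_space (?Ns (of_real s)) w b)"
    using s c(2)[of s] by (intro exI[of _ s] exI[of _ d]) (simp add: scl)
qed

end
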